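(* Let $\mathcal X$ be a finite-dimensional Euclidean space, $\rho:\mathcal X\to\mathbb R\cup\{+\infty\}$ a closed gauge, and $b\in\mathcal X$. Let $\mathcal C=\{x\mid\rho(b-x)\le\sigma\}$ with $0<\sigma<\rho(b)$. Then $$\mathcal C'=\{y\mid\langle b,y\rangle-\sigma\rho^\circ(y)\ge1\}.$$
   Context: A gauge is a nonnegative, positively homogeneous convex function $\rho:\mathcal X\to\mathbb R\cup\{+\infty\}$ with $\rho(0)=0$; it is closed if its epigraph is closed. Its polar is the gauge $\rho^\circ(y)=\inf\{\mu>0\mid\langle x,y\rangle\le\mu\rho(x)\ \forall x\}$ (with $\inf\emptyset=+\infty$). The antipolar of a set $\mathcal C$ is $\mathcal C'=\{y\mid\langle y,x\rangle\ge1\ \forall x\in\mathcal C\}$. *)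

theory Defs
  imports "HOL-Analysis.Analysis"
begin

text \<open>
  Functions into \<open>\<real> \<union> {+\<infinity>}\<close> are modelled as \<^typ>\<open>ereal\<close>-valued functions; the value
  \<open>-\<infinity>\<close> is excluded for gauges by nonnegativity.  As usual, the epigraph is a subset of
  \<open>X \<times> \<real>\<close>, i.e. its second component is a genuine real number.
\<close>

definition epi :: "('a \<Rightarrow> ereal) \<Rightarrow> ('a \<times> real) set" where
  "epi f = {(x, r). f x \<le> ereal r}"

text \<open>Convexity of an extended-real-valued function is convexity of its epigraph.\<close>

definition is_gauge :: "('a::real_vector \<Rightarrow> ereal) \<Rightarrow> bool" where
  "is_gauge \<rho> \<longleftrightarrow>
     (\<forall>x. 0 \<le> \<rho> x) \<and>
     (\<forall>c x. 0 < c \<longrightarrow> \<rho> (c *\<^sub>R x) = ereal c * \<rho> x) \<and>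
     convex (epi \<rho>) \<and>
     \<rho> 0 = 0"

definition closed_gauge :: "('a::real_normed_vector \<Rightarrow> ereal) \<Rightarrow> bool" where
  "closed_gauge \<rho> \<longleftrightarrow> is_gauge \<rho> \<and> closed (epi \<rho>)"

text \<open>The infimum is taken in \<^typ>\<open>ereal\<close>, so that the infimum of the empty set is \<open>+\<infinity>\<close>.\<close>

definition gauge_polar :: "('a::real_inner \<Rightarrow> ereal) \<Rightarrow> 'a \<Rightarrow> ereal" where
  "gauge_polar \<rho> y = Inf {ereal \<mu> |\<mu>. 0 < \<mu> \<and> (\<forall>x. ereal (x \<bullet> y) \<le> ereal \<mu> * \<rho> x)}"

definition antipolar :: "'a::real_inner set \<Rightarrow> 'a set" where
  "antipolar C = {y. \<forall>x\<in>C. y \<bullet> x \<ge> 1}"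

end

theory Submission
  imports Defs
begin

text \<open>
  Substituting \<open>z = b - x\<close>, membership of \<open>y\<close> in the antipolar says that \<open>z \<bullet> y \<le> b \<bullet> y - 1\<close>
  on the sublevel set \<open>\<rho> z \<le> \<sigma>\<close>.  By homogeneity this is the bound
  \<open>\<sigma> \<rho>\<degree>(y) \<le> b \<bullet> y - 1\<close>: points with \<open>0 < \<rho> x < \<infinity>\<close> are rescaled to level \<open>\<sigma>\<close>, while
  \<open>\<rho> x = 0\<close> forces \<open>x \<bullet> y \<le> 0\<close> because the whole ray through \<open>x\<close> lies in the sublevel set.
\<close>

lemma gauge_scaleR:
  assumes "is_gauge \<rho>" "0 < c"
  shows "\<rho> (c *\<^sub>R x) = ereal c * \<rho> x"
  using assms unfolding is_gauge_def by blast

text \<open>This supplies candidates for the infimum in \<open>gauge_polar\<close>: any positive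
  \<open>\<mu>\<close> that is at least \<open>s / \<sigma>\<close> qualifies.\<close>

lemma gauge_polar_feasible:
  assumes gauge: "is_gauge \<rho>" and "0 < \<sigma>" and "0 < \<mu>" and "s \<le> \<mu> * \<sigma>"
    and bound: "\<And>z. \<rho> z \<le> ereal \<sigma> \<Longrightarrow> z \<bullet> y \<le> s"
  shows "ereal (x \<bullet> y) \<le> ereal \<mu> * \<rho> x"
proof -
  have nonneg: "0 \<le> \<rho> x"
    using gauge unfolding is_gauge_def by blast
  show ?thesis
  proof (cases "\<rho> x")
    case (real r)
    have scaled: "c * (x \<bullet> y) \<le> s" if "0 < c" "c * r \<le> \<sigma>" for c
      using bound[of "c *\<^sub>R x"] that gauge_scaleR[OF gauge \<open>0 < c\<close>] real by simp
    have "x \<bullet> y \<le> \<mu> * r"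
    proof (cases "r = 0")
      case True
      show ?thesis
      proof (rule ccontr)
        assume "\<not> x \<bullet> y \<le> \<mu> * r"
        then have pos: "0 < x \<bullet> y" using True by simp
        \<comment> \<open>The factor is chosen so that the product equals
          \<open>\<bar>s\<bar> + 1\<close>, which exceeds \<open>s\<close>.\<close>
        have "(\<bar>s\<bar> + 1) / (x \<bullet> y) * (x \<bullet> y) \<le> s"
          using scaled[of "(\<bar>s\<bar> + 1) / (x \<bullet> y)"] pos True \<open>0 < \<sigma>\<close> by simp
        then show False using pos by simp
      qed
    next
      case False
      then have "0 < r" using nonneg real by simp
      then have "\<sigma> / r * (x \<bullet> y) \<le> \<mu> * \<sigma>"
        using scaled[of "\<sigma> / r"] \<open>0 < \<sigma>\<close> \<open>s \<le> \<mu> * \<sigma>\<close> by simp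
      then show ?thesis
        using \<open>0 < r\<close> \<open>0 < \<sigma>\<close> by (simp add: field_simps)
    qed
    then show ?thesis using real by simp
  \<comment> \<open>If \<open>\<rho> x\<close> is infinite, so is the right-hand side, because
    \<open>\<mu>\<close> is positive.\<close>
  qed (use nonneg \<open>0 < \<mu>\<close> in auto)
qed

lemma gauge_polar_nonneg: "0 \<le> gauge_polar \<rho> y"
  unfolding gauge_polar_def by (rule Inf_greatest) auto

text \<open>By homogeneity, \<open>\<sigma>\<close> times the polar is the support function of the
  sublevel set of \<open>\<rho>\<close> at level \<open>\<sigma>\<close>.\<close>

lemma gauge_polar_le_iff:
  assumes gauge: "is_gauge \<rho>" and "0 < \<sigma>"
  shows "gauge_polar \<rho> y \<le> ereal (s / \<sigma>) \<longleftrightarrow> (\<forall>z. \<rho> z \<le> ereal \<sigma> \<longrightarrow> z \<bullet> y \<le> s)"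
proof (intro iffI allI impI)
  fix z
  assume le: "gauge_polar \<rho> y \<le> ereal (s / \<sigma>)" and z: "\<rho> z \<le> ereal \<sigma>"
  \<comment> \<open>The slack \<open>e\<close> makes the bound on the infimum strict, so that some
    candidate \<open>\<mu>\<close> lies below \<open>(s + e) / \<sigma>\<close>.\<close>
  have "z \<bullet> y \<le> s + e" if "0 < e" for e
  proof -
    have "s / \<sigma> < (s + e) / \<sigma>"
      using that \<open>0 < \<sigma>\<close> by (simp add: divide_strict_right_mono)
    then have "gauge_polar \<rho> y < ereal ((s + e) / \<sigma>)"
      using le by (simp add: le_less_trans)
    then obtain \<mu> where \<mu>: "\<mu> < (s + e) / \<sigma>" "0 < \<mu>" "ereal (z \<bullet> y) \<le> ereal \<mu> * \<rho> z"
      unfolding gauge_polar_def Inf_less_iff by auto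
    have "ereal (z \<bullet> y) \<le> ereal \<mu> * ereal \<sigma>"
      using \<mu> z by (meson ereal_mult_left_mono ereal_less_eq(5) less_imp_le order_trans)
    moreover have "\<mu> * \<sigma> < s + e"
      using \<mu>(1) \<open>0 < \<sigma>\<close> by (simp add: field_simps)
    ultimately show ?thesis by simp
  qed
  then show "z \<bullet> y \<le> s" by (rule field_le_epsilon)
next
  assume bound: "\<forall>z. \<rho> z \<le> ereal \<sigma> \<longrightarrow> z \<bullet> y \<le> s"
  have "\<rho> 0 = 0" using gauge unfolding is_gauge_def by blast
  \<comment> \<open>The origin lies in the sublevel set; take \<open>z = 0\<close>.\<close>
  then have "0 \<le> s" using bound \<open>0 < \<sigma>\<close> by (metis ereal_less_eq(5) inner_zero_left less_imp_le)
  show "gauge_polar \<rho> y \<le> ereal (s / \<sigma>)"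
  proof (rule ereal_le_epsilon2)
    fix e :: real
    assume "0 < e"
    \<comment> \<open>Adding \<open>e\<close> keeps the candidate positive even when
      \<open>s = 0\<close>.\<close>
    let ?\<mu> = "s / \<sigma> + e"
    have "0 < ?\<mu>" "s \<le> ?\<mu> * \<sigma>"
      using \<open>0 \<le> s\<close> \<open>0 < \<sigma>\<close> \<open>0 < e\<close> by (simp_all add: add_nonneg_pos field_simps)
    then have "ereal (x \<bullet> y) \<le> ereal ?\<mu> * \<rho> x" for x
      using gauge_polar_feasible[OF gauge \<open>0 < \<sigma>\<close>] bound by blast
    then have "gauge_polar \<rho> y \<le> ereal ?\<mu>"
      unfolding gauge_polar_def using \<open>0 < ?\<mu>\<close> by (intro Inf_lower) blast
    then show "gauge_polar \<rho> y \<le> ereal (s / \<sigma>) + ereal e" by simp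
  qed
qed

theorem proposition3p1:
  fixes \<rho> :: "'a::euclidean_space \<Rightarrow> ereal" and b :: 'a and \<sigma> :: real and C :: "'a set"
  assumes "closed_gauge \<rho>"
    and "0 < \<sigma>" and "ereal \<sigma> < \<rho> b"
    and "C = {x. \<rho> (b - x) \<le> ereal \<sigma>}"
  shows "antipolar C = {y. ereal (b \<bullet> y) - ereal \<sigma> * gauge_polar \<rho> y \<ge> 1}"
proof (rule set_eqI)
  fix y
  have gauge: "is_gauge \<rho>" using assms(1) unfolding closed_gauge_def by blast
  have "y \<in> antipolar C \<longleftrightarrow> (\<forall>x. \<rho> (b - x) \<le> ereal \<sigma> \<longrightarrow> 1 \<le> y \<bullet> x)"
    using assms(4) by (auto simp: antipolar_def)
  also have "\<dots> \<longleftrightarrow> (\<forall>z. \<rho> z \<le> ereal \<sigma> \<longrightarrow> 1 \<le> y \<bullet> (b - z))"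
    by (metis add_diff_cancel_left' diff_add_cancel diff_diff_eq2)
  also have "\<dots> \<longleftrightarrow> (\<forall>z. \<rho> z \<le> ereal \<sigma> \<longrightarrow> z \<bullet> y \<le> b \<bullet> y - 1)"
    by (simp add: inner_diff_right inner_commute[of y] algebra_simps)
  also have "\<dots> \<longleftrightarrow> gauge_polar \<rho> y \<le> ereal ((b \<bullet> y - 1) / \<sigma>)"
    using gauge_polar_le_iff[OF gauge \<open>0 < \<sigma>\<close>] by blast
  \<comment> \<open>For a finite polar this is division by \<open>\<sigma>\<close>. For an infinite
    one both sides fail, since the difference is then minus infinity.\<close>
  also have "\<dots> \<longleftrightarrow> 1 \<le> ereal (b \<bullet> y) - ereal \<sigma> * gauge_polar \<rho> y"
    using gauge_polar_nonneg[of \<rho> y] \<open>0 < \<sigma>\<close>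
    by (cases "gauge_polar \<rho> y") (auto simp: one_ereal_def field_simps)
  finally show "y \<in> antipolar C \<longleftrightarrow> y \<in> {y. 1 \<le> ereal (b \<bullet> y) - ereal \<sigma> * gauge_polar \<rho> y}"
    by simp
qed

end
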